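(* In a $\dagger$-category with all finite $\dagger$-limits, hom-set addition is cancellable; that is, for arbitrary $f,g,h$ in the same hom-set, $f+h=g+h$ implies $f=g$.
   Context: Composition is written in diagrammatic order: $f;g$ means first $f$, then $g$. A $\dagger$-category is a category with a contravariant endofunctor $\dagger$ that is the identity on objects and satisfies $(f^\dagger)^\dagger=f$. $\dagger$-limits: suppose the $\dagger$-category $\mathbf{C}$ is enriched in commutative monoids, i.e. each hom-set is a commutative monoid $(+,0_{A,B})$ and composition is bilinear. A finite forest-shaped multigraph is a finite directed multigraph (possibly empty) each of whose connected components is a finite tree oriented from its leaves towards a single root, where several parallel arrows between adjacent nodes are allowed; the leaves are the objects that are not the target of any (non-identity) arrow. A finite diagram is a functor $F:\mathbf{J}\to\mathbf{C}$ with $\mathbf{J}$ the free category on such a multigraph. A $\dagger$-limit of $F$ is an ordinary limit $(L,\,l_S:L\to F(S))$ of $F$ satisfying $\sum_{S \text{ leaf of } \mathbf{J}} l_S;l_S^\dagger=\mathrm{id}_L$. $\mathbf{C}$ has all finite $\dagger$-limits if every finite diagram has a $\dagger$-limit (in which case the enrichment is unique). *)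

theory Defs
  imports "HOL-Algebra.FiniteProduct" "Graph_Theory.Digraph_Component" "Graph_Theory.Vertex_Walk"
begin

section \<open>Categories and functors\<close>

record ('o, 'a) category =
  Obj :: "'o set"
  Arr :: "'a set"
  Dom :: "'a \<Rightarrow> 'o"
  Cod :: "'a \<Rightarrow> 'o"
  Id :: "'o \<Rightarrow> 'a"
  Comp :: "'a \<Rightarrow> 'a \<Rightarrow> 'a"  (infixl \<open>\<Zsemi>\<index>\<close> 75)  \<comment> \<open>diagrammatic order: first \<open>f\<close>, then \<open>g\<close>\<close>

definition Hom :: "('o, 'a, 'm) category_scheme \<Rightarrow> 'o \<Rightarrow> 'o \<Rightarrow> 'a set" where
  "Hom C A B = {f \<in> Arr C. Dom C f = A \<and> Cod C f = B}"

locale category =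
  fixes C :: "('o, 'a, 'm) category_scheme" (structure)
  assumes Dom_in_Obj: "f \<in> Arr C \<Longrightarrow> Dom C f \<in> Obj C"
    and Cod_in_Obj: "f \<in> Arr C \<Longrightarrow> Cod C f \<in> Obj C"
    and Id_in_Hom: "A \<in> Obj C \<Longrightarrow> Id C A \<in> Hom C A A"
    and Comp_in_Hom: "\<lbrakk>f \<in> Hom C A B; g \<in> Hom C B D\<rbrakk> \<Longrightarrow> f \<Zsemi> g \<in> Hom C A D"
    and Id_Comp: "f \<in> Hom C A B \<Longrightarrow> Id C A \<Zsemi> f = f"
    and Comp_Id: "f \<in> Hom C A B \<Longrightarrow> f \<Zsemi> Id C B = f"
    and Comp_assoc: "\<lbrakk>f \<in> Hom C A B; g \<in> Hom C B D; h \<in> Hom C D E\<rbrakk>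
          \<Longrightarrow> (f \<Zsemi> g) \<Zsemi> h = f \<Zsemi> (g \<Zsemi> h)"

locale covariant_functor = src: category J + tgt: category C
  for J :: "('i, 'j, 'k) category_scheme" and C :: "('o, 'a, 'm) category_scheme"
    and Fo :: "'i \<Rightarrow> 'o" and Fa :: "'j \<Rightarrow> 'a" +
  assumes Fo_in_Obj: "S \<in> Obj J \<Longrightarrow> Fo S \<in> Obj C"
    and Fa_in_Hom: "u \<in> Hom J S T \<Longrightarrow> Fa u \<in> Hom C (Fo S) (Fo T)"
    and Fa_Id: "S \<in> Obj J \<Longrightarrow> Fa (Id J S) = Id C (Fo S)"
    and Fa_Comp: "\<lbrakk>u \<in> Hom J S T; v \<in> Hom J T U\<rbrakk> \<Longrightarrow> Fa (u \<Zsemi>\<^bsub>J\<^esub> v) = Fa u \<Zsemi>\<^bsub>C\<^esub> Fa v"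

definition is_cone ::
  "('i, 'j, 'k) category_scheme \<Rightarrow> ('o, 'a, 'm) category_scheme \<Rightarrow> ('i \<Rightarrow> 'o) \<Rightarrow> ('j \<Rightarrow> 'a)
    \<Rightarrow> 'o \<Rightarrow> ('i \<Rightarrow> 'a) \<Rightarrow> bool" where
  "is_cone J C Fo Fa X x \<longleftrightarrow>
     X \<in> Obj C \<and> (\<forall>S \<in> Obj J. x S \<in> Hom C X (Fo S)) \<and>
     (\<forall>u \<in> Arr J. x (Dom J u) \<Zsemi>\<^bsub>C\<^esub> Fa u = x (Cod J u))"

definition is_limit ::
  "('i, 'j, 'k) category_scheme \<Rightarrow> ('o, 'a, 'm) category_scheme \<Rightarrow> ('i \<Rightarrow> 'o) \<Rightarrow> ('j \<Rightarrow> 'a)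
    \<Rightarrow> 'o \<Rightarrow> ('i \<Rightarrow> 'a) \<Rightarrow> bool" where
  "is_limit J C Fo Fa L l \<longleftrightarrow>
     is_cone J C Fo Fa L l \<and>
     (\<forall>X x. is_cone J C Fo Fa X x \<longrightarrow>
        (\<exists>!m. m \<in> Hom C X L \<and> (\<forall>S \<in> Obj J. m \<Zsemi>\<^bsub>C\<^esub> l S = x S)))"

section \<open>Enriched dagger categories\<close>

record ('o, 'a) dagger_category = "('o, 'a) category" +
  Dag :: "'a \<Rightarrow> 'a"  (\<open>_\<dagger>\<index>\<close> [1000] 999)

locale dagger_category = category C
  for C :: "('o, 'a, 'm) dagger_category_scheme" (structure) +
  assumes Dag_in_Hom: "f \<in> Hom C A B \<Longrightarrow> f\<dagger> \<in> Hom C B A"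
    and Dag_Id: "A \<in> Obj C \<Longrightarrow> (Id C A)\<dagger> = Id C A"
    and Dag_Comp: "\<lbrakk>f \<in> Hom C A B; g \<in> Hom C B D\<rbrakk> \<Longrightarrow> (f \<Zsemi> g)\<dagger> = g\<dagger> \<Zsemi> f\<dagger>"
    and Dag_Dag: "f \<in> Hom C A B \<Longrightarrow> (f\<dagger>)\<dagger> = f"

record ('o, 'a) enriched_dagger_category = "('o, 'a) dagger_category" +
  Add :: "'a \<Rightarrow> 'a \<Rightarrow> 'a"  (infixl \<open>\<boxplus>\<index>\<close> 65)
  Zero :: "'o \<Rightarrow> 'o \<Rightarrow> 'a"

text \<open>
  Each hom-set as a monoid of HOL-Algebra, whose notation is multiplicative: \<open>mult\<close> is the addition
  of arrows, so \<open>finprod (hom_monoid C A B)\<close> is the finite sum of arrows from \<open>A\<close> to \<open>B\<close>.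
\<close>
definition hom_monoid ::
  "('o, 'a, 'm) enriched_dagger_category_scheme \<Rightarrow> 'o \<Rightarrow> 'o \<Rightarrow> 'a monoid" where
  "hom_monoid C A B = \<lparr>carrier = Hom C A B, monoid.mult = Add C, one = Zero C A B\<rparr>"

text \<open>
  The enrichment concerns the underlying category only: no compatibility of the addition with the
  dagger is assumed.
\<close>
locale enriched_dagger_category = dagger_category C
  for C :: "('o, 'a, 'm) enriched_dagger_category_scheme" (structure) +
  assumes comm_monoid_Hom: "\<lbrakk>A \<in> Obj C; B \<in> Obj C\<rbrakk> \<Longrightarrow> comm_monoid (hom_monoid C A B)"
    and Add_Comp: "\<lbrakk>f \<in> Hom C A B; g \<in> Hom C A B; h \<in> Hom C B D\<rbrakk>
          \<Longrightarrow> (f \<boxplus> g) \<Zsemi> h = (f \<Zsemi> h) \<boxplus> (g \<Zsemi> h)"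
    and Comp_Add: "\<lbrakk>f \<in> Hom C A B; g \<in> Hom C B D; h \<in> Hom C B D\<rbrakk>
          \<Longrightarrow> f \<Zsemi> (g \<boxplus> h) = (f \<Zsemi> g) \<boxplus> (f \<Zsemi> h)"
    and Zero_Comp: "\<lbrakk>A \<in> Obj C; f \<in> Hom C B D\<rbrakk> \<Longrightarrow> Zero C A B \<Zsemi> f = Zero C A D"
    and Comp_Zero: "\<lbrakk>f \<in> Hom C A B; D \<in> Obj C\<rbrakk> \<Longrightarrow> f \<Zsemi> Zero C B D = Zero C A D"

section \<open>Forest-shaped multigraphs and finite diagrams\<close>

text \<open>
  A tree oriented towards a root, up to parallel arcs: every vertex has exactly one directed walk to
  the root. A \<^const>\<open>vwalk\<close> is a list of vertices, so it does not distinguish parallel arcs.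
  Uniqueness excludes loops and directed cycles, and (together with the existence of the walks)
  gives each vertex other than the root exactly one successor and the root none.
\<close>
definition rooted_multitree :: "('v, 'e) pre_digraph \<Rightarrow> bool" where
  "rooted_multitree T \<longleftrightarrow>
     (\<exists>r \<in> verts T. \<forall>v \<in> verts T. \<exists>!p. vwalk p T \<and> hd p = v \<and> last p = r)"

text \<open>Connectedness ignores the orientation of the arcs; the empty graph counts as not connected.\<close>
definition connected_component :: "('v, 'e) pre_digraph \<Rightarrow> ('v, 'e) pre_digraph \<Rightarrow> bool" where
  "connected_component G H \<longleftrightarrow> pre_digraph.max_subgraph G Digraph_Component.connected H"

definition forest_shaped :: "('v, 'e) pre_digraph \<Rightarrow> bool" where
  "forest_shaped G \<longleftrightarrow>
     fin_digraph G \<and> (\<forall>H. connected_component G H \<longrightarrow> rooted_multitree H)"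

text \<open>
  The free category on a multigraph: an arrow from \<open>u\<close> to \<open>v\<close> is a triple \<open>(u, p, v)\<close> with \<open>p\<close> a
  directed path from \<open>u\<close> to \<open>v\<close>, given as a list of arcs.
\<close>
definition free_category :: "('v, 'e) pre_digraph \<Rightarrow> ('v, 'v \<times> 'e list \<times> 'v) category" where
  "free_category G =
     \<lparr>Obj = verts G,
      Arr = {(u, p, v). pre_digraph.awalk G u p v},
      Dom = (\<lambda>(u, p, v). u),
      Cod = (\<lambda>(u, p, v). v),
      Id = (\<lambda>u. (u, [], u)),
      Comp = (\<lambda>(u, p, v) (v', q, w). (u, p @ q, w))\<rparr>"

lemma category_free_category:
  assumes "wf_digraph G"
  shows "category (free_category G)"
proof -
  interpret wf_digraph G by fact
  show ?thesis
    by unfold_locales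
      (auto simp: free_category_def Hom_def awalk_Nil_iff
        dest: awalk_hd_in_verts awalk_last_in_verts intro: awalk_appendI)
qed

definition leaves :: "('i, 'j, 'k) category_scheme \<Rightarrow> 'i set" where
  "leaves J = {S \<in> Obj J. \<forall>u \<in> Arr J. Cod J u = S \<longrightarrow> u = Id J S}"

definition is_dagger_limit ::
  "('i, 'j, 'k) category_scheme \<Rightarrow> ('o, 'a, 'm) enriched_dagger_category_scheme
    \<Rightarrow> ('i \<Rightarrow> 'o) \<Rightarrow> ('j \<Rightarrow> 'a) \<Rightarrow> 'o \<Rightarrow> ('i \<Rightarrow> 'a) \<Rightarrow> bool" where
  "is_dagger_limit J C Fo Fa L l \<longleftrightarrow>
     is_limit J C Fo Fa L l \<and>
     finprod (hom_monoid C L L) (\<lambda>S. l S \<Zsemi>\<^bsub>C\<^esub> (l S)\<dagger>\<^bsub>C\<^esub>) (leaves J) = Id C L"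

text \<open>
  Every finite multigraph is isomorphic to one whose vertices and arcs are natural numbers, so
  quantifying over the latter loses no finite diagram.
\<close>
definition has_finite_dagger_limits :: "('o, 'a, 'm) enriched_dagger_category_scheme \<Rightarrow> bool" where
  "has_finite_dagger_limits C \<longleftrightarrow>
     (\<forall>(G :: (nat, nat) pre_digraph) Fo Fa.
        forest_shaped G \<and> covariant_functor (free_category G) C Fo Fa \<longrightarrow>
        (\<exists>L l. is_dagger_limit (free_category G) C Fo Fa L l))"

end

theory Submission
  imports Defs
begin

text \<open>
  Let \<open>e\<close> be a dagger equalizer of the arrows \<open>[f, h]\<close> and \<open>[g, h]\<close> from the dagger biproduct of \<open>A\<close>
  with itself to \<open>B\<close>. Both the second injection and the diagonal equalize them, the latter because
  \<open>f + h = g + h\<close>, so the projection \<open>P = e\<^sup>\<dagger>;e\<close> fixes both. Being self-adjoint, \<open>P\<close> is a diagonal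
  matrix, and it then fixes the first injection as well, which therefore also equalizes them.
\<close>

section \<open>The graphs with two vertices\<close>

text \<open>One family covers both shapes of limit used below: with \<open>K\<close> empty there are
  two isolated vertices, whose limits are products; with two arcs there is a parallel pair, whose
  limits are equalizers.\<close>

definition parallel_arcs :: "'e set \<Rightarrow> (nat, 'e) pre_digraph" where
  "parallel_arcs K = \<lparr>verts = {0, 1}, arcs = K, tail = (\<lambda>_. 0), head = (\<lambda>_. 1)\<rparr>"

lemma parallel_arcs_simps [simp]:
  "verts (parallel_arcs K) = {0, 1}"
  "arcs (parallel_arcs K) = K"
  "tail (parallel_arcs K) = (\<lambda>_. 0)"
  "head (parallel_arcs K) = (\<lambda>_. 1)"
  by (simp_all add: parallel_arcs_def)

lemma fin_digraph_parallel_arcs: "finite K \<Longrightarrow> fin_digraph (parallel_arcs K)"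
  by unfold_locales auto

lemma wf_digraph_parallel_arcs: "wf_digraph (parallel_arcs K)"
  by unfold_locales auto

text \<open>Every arc ends in 1 and none starts there, so no path has two arcs.\<close>

lemma awalk_parallel_arcs:
  "pre_digraph.awalk (parallel_arcs K) u p v \<longleftrightarrow>
     (u \<in> {0, 1} \<and> v = u \<and> p = []) \<or> (u = 0 \<and> v = 1 \<and> (\<exists>k\<in>K. p = [k]))"
proof -
  interpret wf_digraph "parallel_arcs K" by (rule wf_digraph_parallel_arcs)
  show ?thesis
  proof (cases p)
    case Nil
    then show ?thesis by (auto simp: awalk_simps)
  next
    case (Cons k ks)
    then show ?thesis by (cases ks) (auto simp: awalk_simps)
  qed
qed

lemma vwalk_parallel_arcs:
  "vwalk p (parallel_arcs K) \<longleftrightarrow> p = [0] \<or> p = [1] \<or> p = [0, 1] \<and> K \<noteq> {}"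
  by (cases p rule: vwalk_arcs.cases; cases "tl (tl p)")
    (auto simp: vwalk_def arcs_ends_def arc_to_ends_def)

section \<open>Connected components of the two-vertex graphs\<close>

lemma connected_parallel_arcs:
  assumes "K \<noteq> {}"
  shows "Digraph_Component.connected (parallel_arcs K)"
proof -
  let ?S = "with_proj (mk_symmetric (parallel_arcs K))"
  have arcs: "arcs_ends ?S = {(0, 1), (1, 0)}"
    using assms by (auto simp: mk_symmetric_def arcs_ends_def arc_to_ends_def)
  interpret wf_digraph ?S
    using assms by unfold_locales (auto simp: mk_symmetric_def)
  have "u \<rightarrow>\<^sup>*\<^bsub>?S\<^esub> v" if "u \<in> {0, 1}" "v \<in> {0, 1}" for u v
  proof (cases "u = v")
    case True
    have "u \<in> verts ?S"
      using that by (simp add: mk_symmetric_def)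
    then show ?thesis
      using True by simp
  next
    case False
    then have "(u, v) \<in> arcs_ends ?S"
      using that arcs by auto
    then show ?thesis by (rule reachable_adjI)
  qed
  then show ?thesis
    unfolding Digraph_Component.connected_def strongly_connected_def by (simp add: mk_symmetric_def)
qed

text \<open>The root is 1. Several arcs in \<open>K\<close> do not disturb uniqueness, since all of
  them give the same vertex walk \<open>[0, 1]\<close>.\<close>

lemma rooted_multitree_parallel_arcs:
  assumes "K \<noteq> {}"
  shows "rooted_multitree (parallel_arcs K)"
  unfolding rooted_multitree_def
proof (intro bexI[of _ 1] ballI)
  fix v assume "v \<in> verts (parallel_arcs K)"
  then consider "v = 0" | "v = 1" by auto
  then show "\<exists>!p. vwalk p (parallel_arcs K) \<and> hd p = v \<and> last p = 1"
  proof cases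
    case 1
    then show ?thesis
      using assms by (intro ex1I[of _ "[0, 1]"]) (auto simp: vwalk_parallel_arcs)
  next
    case 2
    then show ?thesis
      by (intro ex1I[of _ "[1]"]) (auto simp: vwalk_parallel_arcs)
  qed
qed simp

text \<open>Symmetrizing adds no arcs to an arcless graph, so reachability is equality there, while
  connectedness demands a nonempty vertex set.\<close>

lemma connected_without_arcs:
  assumes "Digraph_Component.connected H" and "arcs H = {}"
  obtains v where "verts H = {v}"
proof -
  let ?S = "with_proj (mk_symmetric H)"
  have "arcs_ends ?S = {}" "verts ?S = verts H"
    using assms(2) by (auto simp: mk_symmetric_def arcs_ends_def)
  then have "u = v" if "u \<rightarrow>\<^sup>*\<^bsub>?S\<^esub> v" for u v
    using that by (auto simp: reachable_def elim: rtrancl_on.cases)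
  then show thesis
    using assms(1) that \<open>verts ?S = verts H\<close>
    unfolding Digraph_Component.connected_def strongly_connected_def
    by (metis is_singletonI' is_singleton_the_elem)
qed

lemma rooted_multitree_single_vertex:
  assumes "verts H = {v}" and "arcs H = {}"
  shows "rooted_multitree H"
proof -
  have "p = [v]" if "vwalk p H" for p
    using that assms by (cases p rule: vwalk_arcs.cases) (auto simp: vwalk_def arcs_ends_def)
  then show ?thesis
    using assms unfolding rooted_multitree_def
    by (auto simp: vwalk_def intro!: ex1I[of _ "[v]"])
qed

text \<open>Without arcs, each component is a single vertex. With an arc, the whole graph is
  connected, and maximality forces the component to be all of it.\<close>

lemma forest_shaped_parallel_arcs:
  assumes "finite K"
  shows "forest_shaped (parallel_arcs K)"
  unfolding forest_shaped_def
proof (intro conjI allI impI)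
  fix H assume "connected_component (parallel_arcs K) H"
  then have sub: "subgraph H (parallel_arcs K)" and conn: "Digraph_Component.connected H"
    and max: "\<And>H'. \<lbrakk>H' \<noteq> H; subgraph H H'; subgraph H' (parallel_arcs K)\<rbrakk>
        \<Longrightarrow> \<not> Digraph_Component.connected H'"
    by (auto simp: connected_component_def pre_digraph.max_subgraph_def)
  show "rooted_multitree H"
  proof (cases "K = {}")
    case True
    then have "arcs H = {}"
      using sub by (auto simp: subgraph_def)
    then show ?thesis
      using conn connected_without_arcs rooted_multitree_single_vertex by blast
  next
    case False
    have "subgraph (parallel_arcs K) (parallel_arcs K)"
      by (simp add: subgraph_def compatible_def wf_digraph_parallel_arcs)
    then have "parallel_arcs K = H"
      using max[OF _ sub] connected_parallel_arcs[OF False] by blast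
    then show ?thesis
      using rooted_multitree_parallel_arcs[OF False] by simp
  qed
qed (simp add: fin_digraph_parallel_arcs assms)

section \<open>Arrows and leaves of the free category\<close>

lemma free_category_simps:
  "Obj (free_category G) = verts G"
  "Arr (free_category G) = {(u, p, v). pre_digraph.awalk G u p v}"
  "Dom (free_category G) (u, p, v) = u"
  "Cod (free_category G) (u, p, v) = v"
  "Id (free_category G) u = (u, [], u)"
  "Comp (free_category G) (u, p, v) (v', q, w) = (u, p @ q, w)"
  by (simp_all add: free_category_def)

lemma Hom_free_category:
  "w \<in> Hom (free_category G) u v \<longleftrightarrow> (\<exists>p. w = (u, p, v) \<and> pre_digraph.awalk G u p v)"
  by (cases w) (auto simp: Hom_def free_category_simps)

lemma leaves_free_category:
  "leaves (free_category G) =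
     {v \<in> verts G. \<forall>u p. pre_digraph.awalk G u p v \<longrightarrow> u = v \<and> p = []}"
  by (auto simp: leaves_def free_category_simps)

text \<open>This fixes the number of summands in the normalization of a dagger limit: two for a
  product, one for an equalizer, because a single arc already makes 1 a target.\<close>

lemma leaves_parallel_arcs:
  "leaves (free_category (parallel_arcs K)) = (if K = {} then {0, 1} else {0})"
proof (cases "K = {}")
  case True
  then show ?thesis
    by (auto simp: leaves_free_category awalk_parallel_arcs)
next
  case False
  then obtain k where "k \<in> K" by blast
  then have "1 \<notin> leaves (free_category (parallel_arcs K))"
    unfolding leaves_free_category awalk_parallel_arcs by force
  moreover have "0 \<in> leaves (free_category (parallel_arcs K))"
    by (simp add: leaves_free_category awalk_parallel_arcs)
  moreover have "leaves (free_category (parallel_arcs K)) \<subseteq> {0, 1}"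
    by (auto simp: leaves_free_category)
  ultimately show ?thesis
    using False by auto
qed

section \<open>Diagrams on the graphs with two vertices\<close>

text \<open>Paths in \<open>parallel_arcs K\<close> have at most one arc, so the first arc
  determines the image of a nonempty path and no composite over the list is required.\<close>

definition parallel_map ::
  "('o, 'a, 'm) category_scheme \<Rightarrow> (nat \<Rightarrow> 'o) \<Rightarrow> ('e \<Rightarrow> 'a) \<Rightarrow> nat \<times> 'e list \<times> nat \<Rightarrow> 'a" where
  "parallel_map C Fo \<phi> = (\<lambda>(u, p, v). if p = [] then Id C (Fo u) else \<phi> (hd p))"

context category
begin

lemma HomD:
  assumes "f \<in> Hom C A B"
  shows "A \<in> Obj C" "B \<in> Obj C"
  using assms Dom_in_Obj Cod_in_Obj by (auto simp: Hom_def)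

text \<open>In every composable pair at least one path is empty, so functoriality reduces to the
  identity laws of \<open>C\<close>.\<close>

lemma covariant_functor_parallel_map:
  assumes "Fo 0 \<in> Obj C" "Fo 1 \<in> Obj C" "\<And>k. k \<in> K \<Longrightarrow> \<phi> k \<in> Hom C (Fo 0) (Fo 1)"
  shows "covariant_functor (free_category (parallel_arcs K)) C Fo (parallel_map C Fo \<phi>)"
proof -
  interpret J: category "free_category (parallel_arcs K)"
    by (intro category_free_category wf_digraph_parallel_arcs)
  show ?thesis
    using assms
    by unfold_locales
      (auto simp: Hom_free_category awalk_parallel_arcs free_category_simps parallel_map_def
        Id_in_Hom Id_Comp[OF Id_in_Hom] Id_Comp[OF assms(3)] Comp_Id[OF assms(3)]
        simp del: One_nat_def)
qed

text \<open>Identity arrows impose no condition and \<open>X\<close> is an object as the domain of a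
  leg, so only the equations for single arcs remain.\<close>

lemma is_cone_parallel_map:
  assumes "Fo 0 \<in> Obj C" "Fo 1 \<in> Obj C"
  shows "is_cone (free_category (parallel_arcs K)) C Fo (parallel_map C Fo \<phi>) X x \<longleftrightarrow>
    x 0 \<in> Hom C X (Fo 0) \<and> x 1 \<in> Hom C X (Fo 1) \<and> (\<forall>k\<in>K. x 0 \<Zsemi> \<phi> k = x 1)"
proof -
  have Arr: "(\<forall>u\<in>Arr (free_category (parallel_arcs K)). Q u) \<longleftrightarrow>
      Q (0, [], 0) \<and> Q (1, [], 1) \<and> (\<forall>k\<in>K. Q (0, [k], 1))" for Q
    by (auto simp: free_category_simps awalk_parallel_arcs)
  show ?thesis
    unfolding is_cone_def Arr
    using Comp_Id[of "x 0" X] Comp_Id[of "x 1" X]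
    by (auto simp: parallel_map_def free_category_simps simp del: One_nat_def dest: HomD)
qed

end

section \<open>Dagger biproducts and dagger equalizers\<close>

context enriched_dagger_category
begin

section \<open>Sums in the hom-monoids\<close>

lemma Zero_in_Hom: "\<lbrakk>A \<in> Obj C; B \<in> Obj C\<rbrakk> \<Longrightarrow> Zero C A B \<in> Hom C A B"
  using comm_monoid.axioms(1)[OF comm_monoid_Hom, THEN monoid.one_closed]
  by (simp add: hom_monoid_def)

lemma Add_in_Hom: "\<lbrakk>f \<in> Hom C A B; g \<in> Hom C A B\<rbrakk> \<Longrightarrow> f \<boxplus> g \<in> Hom C A B"
  using comm_monoid.axioms(1)[OF comm_monoid_Hom[of A B], THEN monoid.m_closed, of f g]
  by (auto simp: hom_monoid_def dest: HomD)

lemma Add_Zero: "f \<in> Hom C A B \<Longrightarrow> f \<boxplus> Zero C A B = f"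
  using comm_monoid.axioms(1)[OF comm_monoid_Hom[of A B], THEN monoid.r_one, of f]
  by (auto simp: hom_monoid_def dest: HomD)

lemma Zero_Add: "f \<in> Hom C A B \<Longrightarrow> Zero C A B \<boxplus> f = f"
  using comm_monoid.axioms(1)[OF comm_monoid_Hom[of A B], THEN monoid.l_one, of f]
  by (auto simp: hom_monoid_def dest: HomD)

lemma finprod_hom_monoid_insert:
  assumes "finite I" "i \<notin> I" "\<And>j. j \<in> insert i I \<Longrightarrow> x j \<in> Hom C A B"
  shows "finprod (hom_monoid C A B) x (insert i I) = x i \<boxplus> finprod (hom_monoid C A B) x I"
proof -
  interpret M: comm_monoid "hom_monoid C A B"
    using assms(3)[of i] HomD by (intro comm_monoid_Hom) auto
  have "finprod (hom_monoid C A B) x (insert i I) =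
      x i \<otimes>\<^bsub>hom_monoid C A B\<^esub> finprod (hom_monoid C A B) x I"
    using assms by (intro M.finprod_insert) (auto simp: hom_monoid_def)
  then show ?thesis
    by (simp add: hom_monoid_def)
qed

lemma finprod_hom_monoid_singleton:
  assumes "x i \<in> Hom C A B"
  shows "finprod (hom_monoid C A B) x {i} = x i"
proof -
  interpret M: comm_monoid "hom_monoid C A B"
    using assms HomD by (intro comm_monoid_Hom) auto
  have "finprod (hom_monoid C A B) x {} = Zero C A B"
    by (simp only: M.finprod_empty) (simp add: hom_monoid_def)
  then show ?thesis
    using assms finprod_hom_monoid_insert[of "{}" i x A B] by (simp add: Add_Zero)
qed

text \<open>Common source of dagger biproducts and dagger equalizers, free of graphs and functors:
  \<open>p\<close> and \<open>q\<close> are the legs at the vertices 0 and 1, and the case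
  distinction in the normalization reflects which vertices are leaves.\<close>

lemma parallel_arcs_dagger_limit:
  fixes K :: "nat set" and \<phi> :: "nat \<Rightarrow> 'a"
  assumes "has_finite_dagger_limits C" and "finite K"
    and "A \<in> Obj C" "B \<in> Obj C" "\<And>k. k \<in> K \<Longrightarrow> \<phi> k \<in> Hom C A B"
  obtains L p q where "p \<in> Hom C L A" "q \<in> Hom C L B" "\<And>k. k \<in> K \<Longrightarrow> p \<Zsemi> \<phi> k = q"
    "Id C L = (if K = {} then (p \<Zsemi> p\<dagger>) \<boxplus> (q \<Zsemi> q\<dagger>) else p \<Zsemi> p\<dagger>)"
    "\<And>X x y. \<lbrakk>x \<in> Hom C X A; y \<in> Hom C X B; \<And>k. k \<in> K \<Longrightarrow> x \<Zsemi> \<phi> k = y\<rbrakk>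
        \<Longrightarrow> \<exists>m \<in> Hom C X L. m \<Zsemi> p = x \<and> m \<Zsemi> q = y"
proof -
  define Fo where "Fo = (\<lambda>n::nat. if n = 0 then A else B)"
  let ?J = "free_category (parallel_arcs K)" and ?Fa = "parallel_map C Fo \<phi>"
  have Fo: "Fo 0 = A" "Fo 1 = B"
    by (simp_all add: Fo_def)
  have "covariant_functor ?J C Fo ?Fa"
    using assms Fo by (intro covariant_functor_parallel_map) auto
  then obtain L l where lim: "is_limit ?J C Fo ?Fa L l"
    and id: "finprod (hom_monoid C L L) (\<lambda>S. l S \<Zsemi> (l S)\<dagger>) (leaves ?J) = Id C L"
    using assms(1) forest_shaped_parallel_arcs[OF assms(2)]
    unfolding has_finite_dagger_limits_def is_dagger_limit_def by blast
  have cone: "is_cone ?J C Fo ?Fa X x \<longleftrightarrow>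
      x 0 \<in> Hom C X A \<and> x 1 \<in> Hom C X B \<and> (\<forall>k\<in>K. x 0 \<Zsemi> \<phi> k = x 1)" for X x
    using is_cone_parallel_map[of Fo K \<phi> X x] assms Fo by simp
  have l: "l 0 \<in> Hom C L A" "l 1 \<in> Hom C L B" "\<And>k. k \<in> K \<Longrightarrow> l 0 \<Zsemi> \<phi> k = l 1"
    using lim cone by (auto simp: is_limit_def)
  have ll: "l 0 \<Zsemi> (l 0)\<dagger> \<in> Hom C L L" "l 1 \<Zsemi> (l 1)\<dagger> \<in> Hom C L L"
    using l Comp_in_Hom Dag_in_Hom by blast+
  have "Id C L = (if K = {} then (l 0 \<Zsemi> (l 0)\<dagger>) \<boxplus> (l 1 \<Zsemi> (l 1)\<dagger>) else l 0 \<Zsemi> (l 0)\<dagger>)"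
    using id ll finprod_hom_monoid_insert[of "{1}" 0 "\<lambda>S. l S \<Zsemi> (l S)\<dagger>" L L]
      finprod_hom_monoid_singleton[of "\<lambda>S. l S \<Zsemi> (l S)\<dagger>" _ L L]
    by (auto simp: leaves_parallel_arcs split: if_splits)
  moreover have "\<exists>m \<in> Hom C X L. m \<Zsemi> l 0 = x \<and> m \<Zsemi> l 1 = y"
    if "x \<in> Hom C X A" "y \<in> Hom C X B" "\<And>k. k \<in> K \<Longrightarrow> x \<Zsemi> \<phi> k = y" for X x y
  proof -
    have "is_cone ?J C Fo ?Fa X (\<lambda>n. if n = 0 then x else y)"
      using that cone by simp
    then obtain m where "m \<in> Hom C X L" "\<forall>S\<in>Obj ?J. m \<Zsemi> l S = (if S = 0 then x else y)"
      using lim unfolding is_limit_def by blast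
    then show ?thesis
      by (auto simp: free_category_simps)
  qed
  ultimately show thesis
    using l that by blast
qed

text \<open>The normalization makes the daggers of the projections act as injections: the arrows
  with coordinates (identity, zero) and (zero, identity), which the product supplies, turn out to be
  \<open>p\<dagger>\<close> and \<open>q\<dagger>\<close>.\<close>

lemma dagger_biproduct:
  assumes "has_finite_dagger_limits C" and "A \<in> Obj C" "B \<in> Obj C"
  obtains L p q where "p \<in> Hom C L A" "q \<in> Hom C L B"
    "p\<dagger> \<Zsemi> p = Id C A" "p\<dagger> \<Zsemi> q = Zero C A B" "q\<dagger> \<Zsemi> p = Zero C B A" "q\<dagger> \<Zsemi> q = Id C B"
    "Id C L = (p \<Zsemi> p\<dagger>) \<boxplus> (q \<Zsemi> q\<dagger>)"
proof -
  obtain L p q where p: "p \<in> Hom C L A" and q: "q \<in> Hom C L B"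
    and id: "Id C L = (p \<Zsemi> p\<dagger>) \<boxplus> (q \<Zsemi> q\<dagger>)"
    and univ: "\<And>X x y. \<lbrakk>x \<in> Hom C X A; y \<in> Hom C X B\<rbrakk>
        \<Longrightarrow> \<exists>m \<in> Hom C X L. m \<Zsemi> p = x \<and> m \<Zsemi> q = y"
    \<comment> \<open>There are no arcs to interpret, so any family of arrows will do.\<close>
    by (rule parallel_arcs_dagger_limit[of "{}" A B undefined]) (use assms that in auto)
  note pq = p q p[THEN Dag_in_Hom] q[THEN Dag_in_Hom]
  \<comment> \<open>Composing with the normalized identity rebuilds an arrow into \<open>L\<close>
    from its two coordinates.\<close>
  have decomp: "i = ((i \<Zsemi> p) \<Zsemi> p\<dagger>) \<boxplus> ((i \<Zsemi> q) \<Zsemi> q\<dagger>)" if i: "i \<in> Hom C X L" for i X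
  proof -
    have "i = i \<Zsemi> ((p \<Zsemi> p\<dagger>) \<boxplus> (q \<Zsemi> q\<dagger>))"
      using Comp_Id[OF i] id by simp
    also have "\<dots> = (i \<Zsemi> (p \<Zsemi> p\<dagger>)) \<boxplus> (i \<Zsemi> (q \<Zsemi> q\<dagger>))"
      using i pq Comp_in_Hom by (intro Comp_Add) blast+
    finally show ?thesis
      using Comp_assoc[OF i pq(1,3)] Comp_assoc[OF i pq(2,4)] by simp
  qed
  obtain i where i: "i \<in> Hom C A L" "i \<Zsemi> p = Id C A" "i \<Zsemi> q = Zero C A B"
    using univ Id_in_Hom Zero_in_Hom assms by blast
  obtain j where j: "j \<in> Hom C B L" "j \<Zsemi> p = Zero C B A" "j \<Zsemi> q = Id C B"
    using univ Id_in_Hom Zero_in_Hom assms by blast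
  have "i = p\<dagger>"
    using decomp[OF i(1)] i(2,3) pq assms by (simp add: Id_Comp Zero_Comp Add_Zero)
  moreover have "j = q\<dagger>"
    using decomp[OF j(1)] j(2,3) pq assms by (simp add: Id_Comp Zero_Comp Zero_Add)
  ultimately show thesis
    using that p q i j id by blast
qed

text \<open>The only leaf of a parallel pair is its source, so the normalization has one summand and
  says that the equalizing arrow is a dagger monomorphism.\<close>

lemma dagger_equalizer:
  assumes "has_finite_dagger_limits C" and f: "f \<in> Hom C A B" and g: "g \<in> Hom C A B"
  obtains E e where "e \<in> Hom C E A" "e \<Zsemi> e\<dagger> = Id C E" "e \<Zsemi> f = e \<Zsemi> g"
    "\<And>X x. \<lbrakk>x \<in> Hom C X A; x \<Zsemi> f = x \<Zsemi> g\<rbrakk> \<Longrightarrow> \<exists>m \<in> Hom C X E. m \<Zsemi> e = x"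
proof -
  obtain E e d where e: "e \<in> Hom C E A" and eq: "e \<Zsemi> f = d" "e \<Zsemi> g = d" and "Id C E = e \<Zsemi> e\<dagger>"
    and univ: "\<And>X x y. \<lbrakk>x \<in> Hom C X A; y \<in> Hom C X B; x \<Zsemi> f = y; x \<Zsemi> g = y\<rbrakk>
        \<Longrightarrow> \<exists>m \<in> Hom C X E. m \<Zsemi> e = x"
  proof (rule parallel_arcs_dagger_limit[of "{0, 1}" A B "\<lambda>k. if k = 0 then f else g"])
    fix L p q
    assume p: "p \<in> Hom C L A"
      and eq: "\<And>k::nat. k \<in> {0, 1} \<Longrightarrow> p \<Zsemi> (if k = 0 then f else g) = q"
      and id: "Id C L = (if {0, 1::nat} = {} then (p \<Zsemi> p\<dagger>) \<boxplus> (q \<Zsemi> q\<dagger>) else p \<Zsemi> p\<dagger>)"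
      and univ: "\<And>X x y. \<lbrakk>x \<in> Hom C X A; y \<in> Hom C X B;
          \<And>k::nat. k \<in> {0, 1} \<Longrightarrow> x \<Zsemi> (if k = 0 then f else g) = y\<rbrakk>
        \<Longrightarrow> \<exists>m \<in> Hom C X L. m \<Zsemi> p = x \<and> m \<Zsemi> q = y"
    show thesis
    proof (rule that[of p L q])
      fix X x y
      assume "x \<in> Hom C X A" "y \<in> Hom C X B" "x \<Zsemi> f = y" "x \<Zsemi> g = y"
      then have "\<exists>m \<in> Hom C X L. m \<Zsemi> p = x \<and> m \<Zsemi> q = y"
        by (intro univ) auto
      then show "\<exists>m \<in> Hom C X L. m \<Zsemi> p = x"
        by blast
    qed (use p id eq[of 0] eq[of 1] in simp_all)
  qed (use assms HomD[OF f] in simp_all)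
  show thesis
  proof (rule that[of e E])
    fix X x
    assume x: "x \<in> Hom C X A" "x \<Zsemi> f = x \<Zsemi> g"
    show "\<exists>m \<in> Hom C X E. m \<Zsemi> e = x"
      \<comment> \<open>The leg at vertex 1 is the common composite, here
        \<open>x \<Zsemi> f\<close>.\<close>
      by (rule univ[OF x(1) Comp_in_Hom[OF x(1) f] refl x(2)[symmetric]])
  qed (simp_all add: e eq \<open>Id C E = e \<Zsemi> e\<dagger>\<close>)
qed

text \<open>The projection is \<open>e\<dagger> \<Zsemi> e\<close> for a dagger equalizer
  \<open>e\<close>. An equalizing \<open>x\<close> factors as \<open>m \<Zsemi> e\<close>, and
  \<open>e \<Zsemi> e\<dagger>\<close> being the identity gives
  \<open>x \<Zsemi> e\<dagger> = m\<close>, so the projection returns \<open>x\<close>.\<close>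

lemma dagger_equalizer_projection:
  assumes "has_finite_dagger_limits C" and f: "f \<in> Hom C A B" and g: "g \<in> Hom C A B"
  obtains P where "P \<in> Hom C A A" "P\<dagger> = P" "P \<Zsemi> f = P \<Zsemi> g"
    "\<And>X x. \<lbrakk>x \<in> Hom C X A; x \<Zsemi> f = x \<Zsemi> g\<rbrakk> \<Longrightarrow> x \<Zsemi> P = x"
proof -
  obtain E e where e: "e \<in> Hom C E A" and ee: "e \<Zsemi> e\<dagger> = Id C E" and eq: "e \<Zsemi> f = e \<Zsemi> g"
    and univ: "\<And>X x. \<lbrakk>x \<in> Hom C X A; x \<Zsemi> f = x \<Zsemi> g\<rbrakk> \<Longrightarrow> \<exists>m \<in> Hom C X E. m \<Zsemi> e = x"
    by (rule dagger_equalizer[OF assms]) (use that in blast)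
  have d: "e\<dagger> \<in> Hom C A E" using Dag_in_Hom[OF e] .
  have "(e\<dagger> \<Zsemi> e) \<in> Hom C A A"
    using Comp_in_Hom[OF d e] .
  moreover have "(e\<dagger> \<Zsemi> e)\<dagger> = e\<dagger> \<Zsemi> e"
    using Dag_Comp[OF d e] Dag_Dag[OF e] by simp
  moreover have "(e\<dagger> \<Zsemi> e) \<Zsemi> f = (e\<dagger> \<Zsemi> e) \<Zsemi> g"
    using Comp_assoc[OF d e f] Comp_assoc[OF d e g] eq by simp
  moreover have "x \<Zsemi> (e\<dagger> \<Zsemi> e) = x" if x: "x \<in> Hom C X A" "x \<Zsemi> f = x \<Zsemi> g" for X x
  proof -
    obtain m where m: "m \<in> Hom C X E" "m \<Zsemi> e = x"
      using univ[OF x] by blast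
    have "x \<Zsemi> (e\<dagger> \<Zsemi> e) = (x \<Zsemi> e\<dagger>) \<Zsemi> e"
      using Comp_assoc[OF x(1) d e] by simp
    also have "x \<Zsemi> e\<dagger> = m"
      using Comp_assoc[OF m(1) e d] ee m Comp_Id by simp
    finally show ?thesis
      using m by simp
  qed
  ultimately show thesis
    using that by blast
qed

end

section \<open>Cancellation from the matrix entries of an equalizer projection\<close>

theorem lemma2p6:
  fixes C :: "('o, 'a, 'm) enriched_dagger_category_scheme" (structure)
  assumes "enriched_dagger_category C"
    and "has_finite_dagger_limits C"
    and "A \<in> Obj C" and "B \<in> Obj C"
    and "f \<in> Hom C A B" and "g \<in> Hom C A B" and "h \<in> Hom C A B"
    and "f \<boxplus> h = g \<boxplus> h"
  shows "f = g"
proof -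
  interpret enriched_dagger_category C by fact
  note f = \<open>f \<in> Hom C A B\<close> and g = \<open>g \<in> Hom C A B\<close> and h = \<open>h \<in> Hom C A B\<close>
  obtain L p q where p: "p \<in> Hom C L A" and q: "q \<in> Hom C L A"
    and pp: "p\<dagger> \<Zsemi> p = Id C A" and pq: "p\<dagger> \<Zsemi> q = Zero C A A"
    and qp: "q\<dagger> \<Zsemi> p = Zero C A A" and qq: "q\<dagger> \<Zsemi> q = Id C A"
    and id: "Id C L = (p \<Zsemi> p\<dagger>) \<boxplus> (q \<Zsemi> q\<dagger>)"
    using dagger_biproduct[OF assms(2,3,3)] by metis
  note p' = Dag_in_Hom[OF p] and q' = Dag_in_Hom[OF q]

  \<comment> \<open>\<open>row x\<close> is the matrix \<open>[x, h]\<close> out of the biproduct;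
    composing with the injections \<open>p\<dagger>\<close> and \<open>q\<dagger>\<close> recovers
    its entries.\<close>
  define row where "row x = (p \<Zsemi> x) \<boxplus> (q \<Zsemi> h)" for x
  have row: "row x \<in> Hom C L B" "p\<dagger> \<Zsemi> row x = x" "q\<dagger> \<Zsemi> row x = h" if x: "x \<in> Hom C A B" for x
  proof -
    have px: "p \<Zsemi> x \<in> Hom C L B" and qh: "q \<Zsemi> h \<in> Hom C L B"
      using p q x h Comp_in_Hom by blast+
    then show "row x \<in> Hom C L B"
      by (simp add: row_def Add_in_Hom)
    have "p\<dagger> \<Zsemi> row x = ((p\<dagger> \<Zsemi> p) \<Zsemi> x) \<boxplus> ((p\<dagger> \<Zsemi> q) \<Zsemi> h)"
      using Comp_Add[OF p' px qh] Comp_assoc[OF p' p x] Comp_assoc[OF p' q h] by (simp add: row_def)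
    then show "p\<dagger> \<Zsemi> row x = x"
      using x h assms(3) by (simp add: pp pq Id_Comp Zero_Comp Add_Zero)
    have "q\<dagger> \<Zsemi> row x = ((q\<dagger> \<Zsemi> p) \<Zsemi> x) \<boxplus> ((q\<dagger> \<Zsemi> q) \<Zsemi> h)"
      using Comp_Add[OF q' px qh] Comp_assoc[OF q' p x] Comp_assoc[OF q' q h] by (simp add: row_def)
    then show "q\<dagger> \<Zsemi> row x = h"
      using x h assms(3) by (simp add: qp qq Id_Comp Zero_Comp Zero_Add)
  qed

  obtain P where P: "P \<in> Hom C L L" and P_self_adjoint: "P\<dagger> = P" and P_eq: "P \<Zsemi> row f = P \<Zsemi> row g"
    and P_fix: "\<And>x. \<lbrakk>x \<in> Hom C A L; x \<Zsemi> row f = x \<Zsemi> row g\<rbrakk> \<Longrightarrow> x \<Zsemi> P = x"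
    using dagger_equalizer_projection[OF assms(2) row(1)[OF f] row(1)[OF g]] by metis
  \<comment> \<open>Both rows have second entry \<open>h\<close>.\<close>
  have qP: "q\<dagger> \<Zsemi> P = q\<dagger>"
    using P_fix q' row f g by simp
  \<comment> \<open>The hypothesis on sums enters here: the diagonal turns each row into the sum of
    its entries.\<close>
  have diagP: "(p\<dagger> \<boxplus> q\<dagger>) \<Zsemi> P = p\<dagger> \<boxplus> q\<dagger>"
  proof (rule P_fix)
    have "(p\<dagger> \<boxplus> q\<dagger>) \<Zsemi> row x = x \<boxplus> h" if "x \<in> Hom C A B" for x
      using Add_Comp[OF p' q' row(1)[OF that]] row(2,3)[OF that] by simp
    then show "(p\<dagger> \<boxplus> q\<dagger>) \<Zsemi> row f = (p\<dagger> \<boxplus> q\<dagger>) \<Zsemi> row g"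
      using f g assms(8) by simp
  qed (rule Add_in_Hom[OF p' q'])

  have pP: "p\<dagger> \<Zsemi> P \<in> Hom C A L"
    using Comp_in_Hom[OF p' P] .
  \<comment> \<open>Self-adjointness of \<open>P\<close> exchanges its two off-diagonal entries up
    to dagger, and the other one is known because \<open>P\<close> fixes
    \<open>q\<dagger>\<close>.\<close>
  have "(p\<dagger> \<Zsemi> P) \<Zsemi> q = (q\<dagger> \<Zsemi> (P \<Zsemi> p))\<dagger>"
    using Dag_Comp[OF q' Comp_in_Hom[OF P p]] Dag_Comp[OF P p] Dag_Dag[OF q] P_self_adjoint
    by simp
  also have "\<dots> = (q\<dagger> \<Zsemi> p)\<dagger>"
    using Comp_assoc[OF q' P p] qP by simp
  \<comment> \<open>the dagger of this zero arrow is again zero, although the dagger need not preserve sums\<close>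
  also have "\<dots> = Zero C A A"
    using Dag_Comp[OF q' p] Dag_Dag[OF q] pq by simp
  finally have pPq: "(p\<dagger> \<Zsemi> P) \<Zsemi> q = Zero C A A" .

  have "(p\<dagger> \<Zsemi> P) \<Zsemi> p = ((p\<dagger> \<Zsemi> P) \<Zsemi> p) \<boxplus> (q\<dagger> \<Zsemi> p)"
    using Comp_in_Hom[OF pP p] by (simp add: qp Add_Zero)
  also have "\<dots> = ((p\<dagger> \<boxplus> q\<dagger>) \<Zsemi> P) \<Zsemi> p"
    using Add_Comp[OF pP q' p] Add_Comp[OF p' q' P] qP by simp
  also have "\<dots> = (p\<dagger> \<Zsemi> p) \<boxplus> (q\<dagger> \<Zsemi> p)"
    using Add_Comp[OF p' q' p] diagP by simp
  also have "\<dots> = Id C A"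
    using Id_in_Hom[OF assms(3)] by (simp add: pp qp Add_Zero)
  finally have pPp: "(p\<dagger> \<Zsemi> P) \<Zsemi> p = Id C A" .

  \<comment> \<open>The coordinates of \<open>p\<dagger> \<Zsemi> P\<close> are now identity and
    zero, which are those of \<open>p\<dagger>\<close>.\<close>
  have "p\<dagger> \<Zsemi> P = (p\<dagger> \<Zsemi> P) \<Zsemi> ((p \<Zsemi> p\<dagger>) \<boxplus> (q \<Zsemi> q\<dagger>))"
    using Comp_Id[OF pP] id by simp
  also have "\<dots> = (((p\<dagger> \<Zsemi> P) \<Zsemi> p) \<Zsemi> p\<dagger>) \<boxplus> (((p\<dagger> \<Zsemi> P) \<Zsemi> q) \<Zsemi> q\<dagger>)"
    using Comp_Add[OF pP Comp_in_Hom[OF p p'] Comp_in_Hom[OF q q']]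
      Comp_assoc[OF pP p p'] Comp_assoc[OF pP q q'] by simp
  also have "\<dots> = p\<dagger>"
    using p' q' assms(3) by (simp add: pPp pPq Id_Comp Zero_Comp Add_Zero)
  finally have pP_eq: "p\<dagger> \<Zsemi> P = p\<dagger>" .

  \<comment> \<open>The first entries of the two rows agree because \<open>P\<close> equalizes the
    rows and fixes the first injection.\<close>
  have "f = (p\<dagger> \<Zsemi> P) \<Zsemi> row f"
    using pP_eq row(2)[OF f] by simp
  also have "\<dots> = (p\<dagger> \<Zsemi> P) \<Zsemi> row g"
    using Comp_assoc[OF p' P row(1)[OF f]] Comp_assoc[OF p' P row(1)[OF g]] P_eq by simp
  also have "\<dots> = g"
    using pP_eq row(2)[OF g] by simp
  finally show ?thesis .
qed

end
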